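(* For a property $\mathcal{P}$ (a set of finite graphs), the following are equivalent: (A) $\mathcal{P}$ is indiscompositive; (B) $\mathcal{P}$ has a generating set, and moreover, for any graph $L\in\mathcal{P}$ and any generating set $\mathcal{G}$ of $\mathcal{P}$, the set $\mathcal{G}[2\circledast L]$ is also a generating set of $\mathcal{P}$; (C) $\mathcal{P}$ has an ordered generating set $G_1\le G_2\le\cdots$ such that every $G_i$ contains two disjoint copies of $G_{i-1}$ (i.e. contains, as an induced subgraph, some graph in $2\circledast G_{i-1}$); (D) $\mathcal{P}$ has a generating graph $H$ that contains two disjoint copies of itself, i.e. $H$ has an induced subgraph belonging to $2\circledast H$; and moreover, for any countable generating graph $G$ of $\mathcal{P}$ there is a generating graph $H\ge G$ of $\mathcal{P}$ that contains two disjoint copies of itself.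
   Context: Graphs in properties are finite, simple and unlabelled; generating graphs may be infinite. $G\le H$ means $G$ is (isomorphic to) an induced subgraph of $H$. A property $\mathcal{P}$ is induced-hereditary if it is closed under induced subgraphs. $\mathcal{P}$ is indiscompositive (induced-hereditary disjoint compositive) if it is induced-hereditary and for every $G,H\in\mathcal{P}$ there is a graph $K\in\mathcal{P}$ containing $G$ and $H$ as vertex-disjoint induced subgraphs. A generating set for $\mathcal{P}$ is a set $\mathcal{G}\subseteq\mathcal{P}$ such that every graph in $\mathcal{P}$ is an induced subgraph of some member of $\mathcal{G}$; it is ordered if its elements can be listed (finitely or infinitely) as $G_1\le G_2\le\cdots$. A generating graph for $\mathcal{P}$ is a (finite or infinite) graph $H$ such that $\mathcal{P}=\{G \mid G\le H,\ |V(G)|\text{ finite}\}$. For a graph $L$, $2\circledast L$ is the set of all graphs consisting of two vertex-disjoint copies of $L$ with arbitrary edges added between the two copies. For a set $\mathcal{G}$ of graphs, $\mathcal{G}[2\circledast L]$ is the set of graphs in $\mathcal{G}$ that contain, as an induced subgraph, some graph in $2\circledast L$.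
   Formalization: A generating set must also have all induced subgraphs of its members in P (else P={K_{2^n}} satisfies (B),(C) but not (A)); the list in (C) is infinite, repetitions allowed (else P={K_0,K_1} is a counterexample); and P is non-empty (the empty property satisfies (A) but not (D)). *)

theory Defs
  imports "HOL-Library.Countable_Set"
begin

text \<open>
  Graphs are pairs of a vertex set and a set of two-element edges; the vertex set may be empty
  or infinite.
\<close>

type_synonym 'a graph = "'a set \<times> 'a set set"

abbreviation verts :: "'a graph \<Rightarrow> 'a set" where
  "verts G \<equiv> fst G"

abbreviation edges :: "'a graph \<Rightarrow> 'a set set" where
  "edges G \<equiv> snd G"

definition simple_graph :: "'a graph \<Rightarrow> bool" where
  "simple_graph G \<longleftrightarrow> (\<forall>e\<in>edges G. e \<subseteq> verts G \<and> card e = 2)"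

definition fin_graph :: "'a graph \<Rightarrow> bool" where
  "fin_graph G \<longleftrightarrow> simple_graph G \<and> finite (verts G)"

definition graph_iso :: "'a graph \<Rightarrow> 'b graph \<Rightarrow> bool" (infix "\<cong>\<^sub>g" 50) where
  "G \<cong>\<^sub>g H \<longleftrightarrow>
     (\<exists>f. bij_betw f (verts G) (verts H) \<and>
          (\<forall>x\<in>verts G. \<forall>y\<in>verts G. {x, y} \<in> edges G \<longleftrightarrow> {f x, f y} \<in> edges H))"

definition induced :: "'a graph \<Rightarrow> 'a set \<Rightarrow> 'a graph" where
  "induced G A = (A, {e \<in> edges G. e \<subseteq> A})"

definition induced_sub :: "'a graph \<Rightarrow> 'b graph \<Rightarrow> bool" (infix "\<le>\<^sub>g" 50) where
  "G \<le>\<^sub>g H \<longleftrightarrow> (\<exists>A \<subseteq> verts H. G \<cong>\<^sub>g induced H A)"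

text \<open>
  Sets of unlabelled finite graphs are represented by isomorphism-closed sets of finite graphs
  with vertices in \<^typ>\<open>nat\<close>. A property is non-empty: a generating graph always generates at
  least the graph without vertices.
\<close>

definition graph_property :: "nat graph set \<Rightarrow> bool" where
  "graph_property P \<longleftrightarrow>
     P \<noteq> {} \<and> (\<forall>G\<in>P. fin_graph G) \<and> (\<forall>G\<in>P. \<forall>H. simple_graph H \<and> G \<cong>\<^sub>g H \<longrightarrow> H \<in> P)"

definition induced_hereditary :: "nat graph set \<Rightarrow> bool" where
  "induced_hereditary P \<longleftrightarrow> (\<forall>H\<in>P. \<forall>G. fin_graph G \<and> G \<le>\<^sub>g H \<longrightarrow> G \<in> P)"

definition contains_disjoint :: "'a graph \<Rightarrow> 'b graph \<Rightarrow> 'c graph \<Rightarrow> bool" where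
  "contains_disjoint K G H \<longleftrightarrow>
     (\<exists>A B. A \<subseteq> verts K \<and> B \<subseteq> verts K \<and> A \<inter> B = {} \<and> G \<cong>\<^sub>g induced K A \<and> H \<cong>\<^sub>g induced K B)"

definition indiscompositive :: "nat graph set \<Rightarrow> bool" where
  "indiscompositive P \<longleftrightarrow>
     induced_hereditary P \<and> (\<forall>G\<in>P. \<forall>H\<in>P. \<exists>K\<in>P. contains_disjoint K G H)"

text \<open>
  A generating set determines the property as the set of all induced subgraphs of its members.
  For induced-hereditary properties the last conjunct is redundant, see
  \<open>generating_set_hereditary\<close>; without it every set of graphs would be a generating set of itself.
\<close>

definition generating_set :: "nat graph set \<Rightarrow> nat graph set \<Rightarrow> bool" where
  "generating_set P \<G> \<longleftrightarrow>
     \<G> \<subseteq> P \<and> (\<forall>G\<in>P. \<exists>K\<in>\<G>. G \<le>\<^sub>g K) \<and> (\<forall>K\<in>\<G>. \<forall>G. fin_graph G \<and> G \<le>\<^sub>g K \<longrightarrow> G \<in> P)"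

lemma generating_set_hereditary:
  assumes "induced_hereditary P"
  shows "generating_set P \<G> \<longleftrightarrow> \<G> \<subseteq> P \<and> (\<forall>G\<in>P. \<exists>K\<in>\<G>. G \<le>\<^sub>g K)"
  using assms unfolding generating_set_def induced_hereditary_def by blast

definition generating_graph :: "nat graph set \<Rightarrow> 'a graph \<Rightarrow> bool" where
  "generating_graph P H \<longleftrightarrow> simple_graph H \<and> P = {G. fin_graph G \<and> G \<le>\<^sub>g H}"

definition two_copies :: "'a graph \<Rightarrow> 'a graph set" ("2\<circledast> _" [90] 90) where
  "2\<circledast> L =
     {M. simple_graph M \<and>
         (\<exists>A B. verts M = A \<union> B \<and> A \<inter> B = {} \<and> L \<cong>\<^sub>g induced M A \<and> L \<cong>\<^sub>g induced M B)}"

definition containing_some :: "'a graph set \<Rightarrow> 'a graph set \<Rightarrow> 'a graph set" where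
  "containing_some \<G> \<M> = {K \<in> \<G>. \<exists>M\<in>\<M>. M \<le>\<^sub>g K}"

end

theory Submission
  imports Defs "HOL-Library.Ramsey"
begin

text \<open>
  The hard part is to find, for a countable generating graph \<open>U\<close> of an indiscompositive property, a
  generating graph above \<open>U\<close> that contains two disjoint copies of itself. A naive iterated doubling
  of \<open>U\<close> has no reason to do so, since the embeddings of successive stages need not be coherent.
  Instead one takes infinitely many copies of \<open>U\<close>, indexed by the natural numbers, such that for
  \<open>i < j\<close> the adjacency of \<open>(s, i)\<close> and \<open>(t, j)\<close> depends on \<open>s\<close> and \<open>t\<close> only. Then any two strictly
  increasing index maps with disjoint ranges, such as \<open>i \<mapsto> 2 i\<close> and \<open>i \<mapsto> 2 i + 1\<close>, give two disjoint
  copies. The adjacency pattern exists by Ramsey's theorem for every finite piece of \<open>U\<close> and finite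
  number of copies, and globally by Koenig's lemma.

  To get from (B) to disjoint compositivity for \<open>G\<close> and \<open>H\<close>, use (B) twice: once for \<open>G\<close> to find a
  member \<open>L\<close> of the property above both \<open>G\<close> and \<open>H\<close>, and then for \<open>L\<close>.
\<close>

declare split_paired_All [simp del] split_paired_Ex [simp del]

subsection \<open>Embeddings\<close>

text \<open>Induced containment with the map made explicit, so that compositions and disjointness of
  images can be followed.\<close>

definition embedding :: "('a \<Rightarrow> 'b) \<Rightarrow> 'a graph \<Rightarrow> 'b graph \<Rightarrow> bool" where
  "embedding f G H \<longleftrightarrow> inj_on f (verts G) \<and> f ` verts G \<subseteq> verts H \<and>
     (\<forall>x\<in>verts G. \<forall>y\<in>verts G. {x, y} \<in> edges G \<longleftrightarrow> {f x, f y} \<in> edges H)"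

lemma embedding_id: "embedding id G G"
  by (simp add: embedding_def)

lemma embedding_comp:
  assumes "embedding f G H" "embedding g H K"
  shows "embedding (g \<circ> f) G K"
proof -
  have "inj_on (g \<circ> f) (verts G)"
    using assms by (auto simp: embedding_def intro: comp_inj_on inj_on_subset)
  moreover have "(g \<circ> f) ` verts G \<subseteq> verts K"
    using assms by (fastforce simp: embedding_def)
  moreover have "{x, y} \<in> edges G \<longleftrightarrow> {(g \<circ> f) x, (g \<circ> f) y} \<in> edges K"
    if "x \<in> verts G" "y \<in> verts G" for x y
  proof -
    have "f x \<in> verts H" "f y \<in> verts H"
      using assms(1) that by (auto simp: embedding_def)
    then show ?thesis
      using assms that by (simp add: embedding_def)
  qed
  ultimately show ?thesis
    by (simp add: embedding_def)
qed

text \<open>The map takes its values in \<open>A\<close>, so the restriction to edges inside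
  \<open>A\<close> is automatic for pairs of images, and edges can be compared in \<open>H\<close>
  itself.\<close>

lemma graph_iso_induced_iff:
  "G \<cong>\<^sub>g induced H A \<longleftrightarrow>
     (\<exists>f. bij_betw f (verts G) A \<and>
          (\<forall>x\<in>verts G. \<forall>y\<in>verts G. {x, y} \<in> edges G \<longleftrightarrow> {f x, f y} \<in> edges H))"
  unfolding graph_iso_def induced_def by (rule arg_cong[of _ _ Ex]) (fastforce simp: bij_betw_def)

lemma graph_iso_iff: "G \<cong>\<^sub>g H \<longleftrightarrow> (\<exists>f. embedding f G H \<and> f ` verts G = verts H)"
  unfolding graph_iso_def embedding_def bij_betw_def by blast

lemma graph_iso_induced_iff_embedding:
  assumes "A \<subseteq> verts H"
  shows "G \<cong>\<^sub>g induced H A \<longleftrightarrow> (\<exists>f. embedding f G H \<and> f ` verts G = A)"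
  unfolding graph_iso_induced_iff embedding_def bij_betw_def using assms by blast

lemma induced_sub_iff: "G \<le>\<^sub>g H \<longleftrightarrow> (\<exists>f. embedding f G H)"
proof -
  have "f ` verts G \<subseteq> verts H" if "embedding f G H" for f
    using that by (simp add: embedding_def)
  then show ?thesis
    unfolding induced_sub_def by (metis graph_iso_induced_iff_embedding)
qed

lemma induced_sub_refl: "G \<le>\<^sub>g G"
  using embedding_id induced_sub_iff by blast

lemma induced_sub_trans: "G \<le>\<^sub>g H \<Longrightarrow> H \<le>\<^sub>g K \<Longrightarrow> G \<le>\<^sub>g K"
  by (meson embedding_comp induced_sub_iff)

lemma contains_disjoint_iff:
  "contains_disjoint K G H \<longleftrightarrow>
     (\<exists>f g. embedding f G K \<and> embedding g H K \<and> f ` verts G \<inter> g ` verts H = {})"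
proof
  assume "contains_disjoint K G H"
  then show "\<exists>f g. embedding f G K \<and> embedding g H K \<and> f ` verts G \<inter> g ` verts H = {}"
    unfolding contains_disjoint_def by (metis graph_iso_induced_iff_embedding)
next
  assume "\<exists>f g. embedding f G K \<and> embedding g H K \<and> f ` verts G \<inter> g ` verts H = {}"
  then obtain f g where fg: "embedding f G K" "embedding g H K" "f ` verts G \<inter> g ` verts H = {}"
    by blast
  then have sub: "f ` verts G \<subseteq> verts K" "g ` verts H \<subseteq> verts K"
    by (simp_all add: embedding_def)
  then show "contains_disjoint K G H"
    unfolding contains_disjoint_def using fg
    by (intro exI[of _ "f ` verts G"] exI[of _ "g ` verts H"])
      (auto simp: graph_iso_induced_iff_embedding)
qed

text \<open>Compose the given embeddings with those of the smaller parts and of the larger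
  container; disjointness survives because the outermost map \<open>c\<close> is injective on all of
  \<open>K\<close>.\<close>

lemma contains_disjoint_mono:
  assumes "contains_disjoint K G H" "G' \<le>\<^sub>g G" "H' \<le>\<^sub>g H" "K \<le>\<^sub>g K'"
  shows "contains_disjoint K' G' H'"
proof -
  obtain f g where fg: "embedding f G K" "embedding g H K" "f ` verts G \<inter> g ` verts H = {}"
    using assms(1) by (auto simp: contains_disjoint_iff)
  obtain a b c where abc: "embedding a G' G" "embedding b H' H" "embedding c K K'"
    using assms(2-4) by (auto simp: induced_sub_iff)
  have sub: "f ` verts G \<subseteq> verts K" "g ` verts H \<subseteq> verts K" "inj_on c (verts K)"
    "a ` verts G' \<subseteq> verts G" "b ` verts H' \<subseteq> verts H"
    using fg abc by (auto simp: embedding_def)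
  have "c ` f ` a ` verts G' \<inter> c ` g ` b ` verts H' \<subseteq> c ` f ` verts G \<inter> c ` g ` verts H"
    using sub by (intro Int_mono image_mono)
  also have "\<dots> = c ` (f ` verts G \<inter> g ` verts H)"
    using sub by (simp add: inj_on_image_Int)
  finally have "(c \<circ> (f \<circ> a)) ` verts G' \<inter> (c \<circ> (g \<circ> b)) ` verts H' = {}"
    using fg(3) by (simp add: image_comp comp_assoc)
  moreover have "embedding (c \<circ> (f \<circ> a)) G' K'" "embedding (c \<circ> (g \<circ> b)) H' K'"
    using fg abc by (auto intro: embedding_comp)
  ultimately show ?thesis
    unfolding contains_disjoint_iff by blast
qed

lemma contains_disjoint_imp_induced_sub:
  assumes "contains_disjoint K G H"
  shows "G \<le>\<^sub>g K" "H \<le>\<^sub>g K"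
  using assms by (auto simp: contains_disjoint_iff induced_sub_iff)

lemma verts_induced [simp]: "verts (induced G A) = A"
  by (simp add: induced_def)

lemma simple_graph_induced: "simple_graph G \<Longrightarrow> simple_graph (induced G A)"
  by (simp add: simple_graph_def induced_def)

lemma embedding_induced: "A \<subseteq> verts G \<Longrightarrow> embedding id (induced G A) G"
  by (auto simp: embedding_def induced_def)

lemma embedding_into_induced:
  "embedding f G H \<Longrightarrow> f ` verts G \<subseteq> A \<Longrightarrow> embedding f G (induced H A)"
  by (auto simp: embedding_def induced_def)

text \<open>The edges between the two copies are arbitrary, so only the disjoint copies matter: the
  union of any two induces a member of \<open>2\<circledast> L\<close>. This lets later arguments
  work with \<open>contains_disjoint\<close>.\<close>

lemma ex_two_copies_iff:
  fixes K L :: "'a graph"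
  assumes "simple_graph K"
  shows "(\<exists>M \<in> 2\<circledast> L. M \<le>\<^sub>g K) \<longleftrightarrow> contains_disjoint K L L"
proof
  assume "\<exists>M \<in> 2\<circledast> L. M \<le>\<^sub>g K"
  then obtain M where M: "M \<in> 2\<circledast> L" "M \<le>\<^sub>g K"
    by blast
  then have "contains_disjoint M L L"
    unfolding two_copies_def contains_disjoint_def by blast
  then show "contains_disjoint K L L"
    using contains_disjoint_mono induced_sub_refl M(2) by blast
next
  assume "contains_disjoint K L L"
  then obtain f g where fg: "embedding f L K" "embedding g L K" "f ` verts L \<inter> g ` verts L = {}"
    by (auto simp: contains_disjoint_iff)
  define M where "M = induced K (f ` verts L \<union> g ` verts L)"
  have V: "verts M = f ` verts L \<union> g ` verts L"
    by (simp add: M_def)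
  have "embedding f L M" "embedding g L M"
    using fg by (auto simp: M_def intro: embedding_into_induced)
  then have "L \<cong>\<^sub>g induced M (f ` verts L)" "L \<cong>\<^sub>g induced M (g ` verts L)"
    using V by (auto simp: graph_iso_induced_iff_embedding)
  then have "M \<in> 2\<circledast> L"
    using V fg(3) simple_graph_induced[OF assms] unfolding two_copies_def M_def by blast
  moreover have "M \<le>\<^sub>g K"
    unfolding M_def induced_sub_iff using fg
    by (intro exI[of _ id] embedding_induced) (simp add: embedding_def)
  ultimately show "\<exists>M \<in> 2\<circledast> L. M \<le>\<^sub>g K"
    by blast
qed

section \<open>Relabelling of vertices\<close>

definition image_graph :: "('a \<Rightarrow> 'b) \<Rightarrow> 'a graph \<Rightarrow> 'b graph" where
  "image_graph f G = (f ` verts G, (`) f ` edges G)"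

lemma verts_image_graph [simp]: "verts (image_graph f G) = f ` verts G"
  by (simp add: image_graph_def)

lemma
  assumes "simple_graph G" "inj_on f (verts G)"
  shows simple_graph_image_graph: "simple_graph (image_graph f G)"
    and embedding_image_graph: "embedding f G (image_graph f G)"
    and embedding_image_graph_inv: "embedding (inv_into (verts G) f) (image_graph f G) G"
proof -
  have E: "e \<subseteq> verts G" "card e = 2" if "e \<in> edges G" for e
    using assms(1) that by (auto simp: simple_graph_def)
  then show "simple_graph (image_graph f G)"
    using assms(2) by (auto simp: simple_graph_def image_graph_def card_image inj_on_subset)
  have "f ` {x, y} \<in> (`) f ` edges G \<longleftrightarrow> {x, y} \<in> edges G" if "x \<in> verts G" "y \<in> verts G" for x y
  proof
    assume "f ` {x, y} \<in> (`) f ` edges G"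
    then obtain e where e: "e \<in> edges G" "f ` {x, y} = f ` e"
      by blast
    then have "{x, y} = e"
      using inj_on_image_eq_iff[OF assms(2), of "{x, y}" e] E that by simp
    then show "{x, y} \<in> edges G"
      using e by simp
  qed blast
  then show emb: "embedding f G (image_graph f G)"
    using assms(2) by (simp add: embedding_def image_graph_def)
  show "embedding (inv_into (verts G) f) (image_graph f G) G"
    unfolding embedding_def
  proof (intro conjI ballI)
    fix u v assume "u \<in> verts (image_graph f G)" "v \<in> verts (image_graph f G)"
    then obtain x y where "x \<in> verts G" "y \<in> verts G" "u = f x" "v = f y"
      by auto
    then show "{u, v} \<in> edges (image_graph f G) \<longleftrightarrow>
        {inv_into (verts G) f u, inv_into (verts G) f v} \<in> edges G"
      using emb assms(2) by (simp add: embedding_def)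
  qed (use assms(2) in \<open>auto simp: inj_on_inv_into\<close>)
qed

text \<open>Containment both ways is what transitivity and \<open>contains_disjoint_mono\<close>
  consume when a graph is replaced by a relabelled copy.\<close>

lemma image_graph_equiv:
  assumes "simple_graph G" "inj_on f (verts G)"
  shows "G \<le>\<^sub>g image_graph f G" "image_graph f G \<le>\<^sub>g G"
  using embedding_image_graph[OF assms] embedding_image_graph_inv[OF assms]
  unfolding induced_sub_iff by metis+

subsection \<open>Generating sets and indiscompositivity\<close>

lemma graph_property_fin: "graph_property P \<Longrightarrow> G \<in> P \<Longrightarrow> fin_graph G"
  by (simp add: graph_property_def)

lemma graph_property_simple: "graph_property P \<Longrightarrow> G \<in> P \<Longrightarrow> simple_graph G"
  by (simp add: graph_property_def fin_graph_def)

lemma fin_graph_image_graph: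
  "fin_graph G \<Longrightarrow> inj_on f (verts G) \<Longrightarrow> fin_graph (image_graph f G)"
  by (simp add: fin_graph_def simple_graph_image_graph)

lemma induced_hereditaryD:
  "induced_hereditary P \<Longrightarrow> H \<in> P \<Longrightarrow> fin_graph G \<Longrightarrow> G \<le>\<^sub>g H \<Longrightarrow> G \<in> P"
  unfolding induced_hereditary_def by blast

lemma indiscompositiveE:
  assumes "indiscompositive P" "G \<in> P" "H \<in> P"
  obtains K where "K \<in> P" "contains_disjoint K G H"
  using assms unfolding indiscompositive_def by meson

lemma generating_setE:
  assumes "generating_set P \<G>" "G \<in> P"
  obtains K where "K \<in> \<G>" "G \<le>\<^sub>g K"
  using assms unfolding generating_set_def by meson

lemma generating_set_subset: "generating_set P \<G> \<Longrightarrow> \<G> \<subseteq> P"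
  by (simp add: generating_set_def)

lemma generating_set_self: "induced_hereditary P \<Longrightarrow> generating_set P P"
  unfolding generating_set_def induced_hereditary_def
  using induced_sub_refl by blast

text \<open>This rests on the last conjunct of \<open>generating_set\<close>: an induced subgraph of
  a member of \<open>P\<close> also lies below a generator, and every finite graph below a generator
  belongs to \<open>P\<close>.\<close>

lemma induced_hereditary_if_generating_set:
  assumes "generating_set P \<G>"
  shows "induced_hereditary P"
  unfolding induced_hereditary_def
proof (intro ballI allI impI)
  fix H G :: "nat graph"
  assume "H \<in> P" and G: "fin_graph G \<and> G \<le>\<^sub>g H"
  then obtain K where K: "K \<in> \<G>" "H \<le>\<^sub>g K"
    using generating_setE[OF assms] by metis
  then have "G \<le>\<^sub>g K"
    using G induced_sub_trans by metis
  then show "G \<in> P"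
    using assms K(1) G unfolding generating_set_def by metis
qed

text \<open>\<open>K1\<close> holds two disjoint copies of \<open>L\<close>, \<open>K2\<close> joins
  \<open>K1\<close> to \<open>G\<close>, and any generator above \<open>K2\<close> inherits the
  copies and lies above \<open>G\<close>.\<close>

lemma indiscompositive_imp_generating_containing:
  assumes P: "graph_property P" "indiscompositive P"
    and L: "L \<in> P" and gen: "generating_set P \<G>"
  shows "generating_set P (containing_some \<G> (2\<circledast> L))"
proof -
  have "\<exists>K\<in>containing_some \<G> (2\<circledast> L). G \<le>\<^sub>g K" if G: "G \<in> P" for G
  proof -
    obtain K1 where K1: "K1 \<in> P" "contains_disjoint K1 L L"
      using indiscompositiveE[OF P(2) L L] .
    obtain K2 where K2: "K2 \<in> P" "contains_disjoint K2 K1 G"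
      using indiscompositiveE[OF P(2) K1(1) G] .
    obtain K where K: "K \<in> \<G>" "K2 \<le>\<^sub>g K"
      using generating_setE[OF gen K2(1)] .
    have le: "K1 \<le>\<^sub>g K" "G \<le>\<^sub>g K"
      using contains_disjoint_imp_induced_sub[OF K2(2)] K(2) by (auto intro: induced_sub_trans)
    have "contains_disjoint K L L"
      by (rule contains_disjoint_mono[OF K1(2) induced_sub_refl induced_sub_refl le(1)])
    moreover have "simple_graph K"
      using K(1) generating_set_subset[OF gen] graph_property_simple[OF P(1)] by (metis subsetD)
    ultimately have "K \<in> containing_some \<G> (2\<circledast> L)"
      using K(1) by (simp add: containing_some_def ex_two_copies_iff)
    then show ?thesis
      using le(2) by blast
  qed
  then show ?thesis
    using gen unfolding generating_set_def containing_some_def by blast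
qed

lemma indiscompositive_if_generating_containing:
  assumes P: "graph_property P" and ex: "generating_set P \<G>"
    and all: "\<And>L \<G>. L \<in> P \<Longrightarrow> generating_set P \<G> \<Longrightarrow>
      generating_set P (containing_some \<G> (2\<circledast> L))"
  shows "indiscompositive P"
proof -
  have her: "induced_hereditary P"
    using ex by (rule induced_hereditary_if_generating_set)
  \<comment> \<open>Condition (B) for the generating set \<open>P\<close> itself. Here
    \<open>H\<close> may still overlap both copies of \<open>G\<close>, which is why a second
    application to \<open>L\<close> follows.\<close>
  have join: "\<exists>K\<in>P. contains_disjoint K G G \<and> H \<le>\<^sub>g K" if GH: "G \<in> P" "H \<in> P" for G H
  proof -
    have "generating_set P (containing_some P (2\<circledast> G))"
      by (rule all[OF GH(1) generating_set_self[OF her]])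
    then obtain K where K: "K \<in> containing_some P (2\<circledast> G)" "H \<le>\<^sub>g K"
      using GH(2) by (rule generating_setE)
    then have "K \<in> P" "\<exists>M \<in> 2\<circledast> G. M \<le>\<^sub>g K"
      by (simp_all add: containing_some_def)
    then show ?thesis
      using K(2) ex_two_copies_iff[OF graph_property_simple[OF P]] by blast
  qed
  have "\<exists>K\<in>P. contains_disjoint K G H" if GH: "G \<in> P" "H \<in> P" for G H
  proof -
    obtain L where L: "L \<in> P" "contains_disjoint L G G" "H \<le>\<^sub>g L"
      using join GH by blast
    obtain K where K: "K \<in> P" "contains_disjoint K L L"
      using join L by blast
    have "G \<le>\<^sub>g L"
      using L(2) by (rule contains_disjoint_imp_induced_sub)
    then have "contains_disjoint K G H"
      by (rule contains_disjoint_mono[OF K(2) _ L(3) induced_sub_refl])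
    then show ?thesis
      using K(1) by blast
  qed
  then show ?thesis
    using her by (simp add: indiscompositive_def)
qed

lemma chain_induced_sub:
  assumes "\<And>i. G i \<le>\<^sub>g G (Suc i)" "m \<le> n"
  shows "G m \<le>\<^sub>g G n"
  using assms(2)
proof (induction rule: dec_induct)
  case base
  show ?case
    by (rule induced_sub_refl)
next
  case (step k)
  show ?case
    by (rule induced_sub_trans[OF step.IH assms(1)])
qed

text \<open>Any two members of \<open>P\<close> lie below a common stage of the chain, and the next
  stage has two disjoint copies of it, one for each.\<close>

lemma indiscompositive_if_chain:
  assumes gen: "generating_set P (range G)"
    and le: "\<And>i. G i \<le>\<^sub>g G (Suc i)" and dbl: "\<And>i. contains_disjoint (G (Suc i)) (G i) (G i)"
  shows "indiscompositive P"
proof -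
  have "\<exists>K\<in>P. contains_disjoint K A B" if AB: "A \<in> P" "B \<in> P" for A B
  proof -
    have "\<exists>i. X \<le>\<^sub>g G i" if "X \<in> P" for X
      using gen that by (simp add: generating_set_def)
    then obtain i j where "A \<le>\<^sub>g G i" "B \<le>\<^sub>g G j"
      using AB by meson
    moreover have "G i \<le>\<^sub>g G (max i j)" "G j \<le>\<^sub>g G (max i j)"
      using chain_induced_sub[of G, OF le] by simp_all
    ultimately have "A \<le>\<^sub>g G (max i j)" "B \<le>\<^sub>g G (max i j)"
      using induced_sub_trans by metis+
    then have "contains_disjoint (G (Suc (max i j))) A B"
      by (rule contains_disjoint_mono[OF dbl _ _ induced_sub_refl])
    moreover have "G (Suc (max i j)) \<in> P"
      using generating_set_subset[OF gen] by blast
    ultimately show ?thesis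
      by blast
  qed
  then show ?thesis
    using induced_hereditary_if_generating_set[OF gen] by (simp add: indiscompositive_def)
qed

text \<open>Take \<open>A\<close> from one copy of \<open>H\<close> and \<open>B\<close> from the
  other. The finitely many vertices used induce a finite graph below \<open>H\<close>, which becomes
  a member of \<open>P\<close> once its vertices are renamed to numbers.\<close>

lemma indiscompositive_if_generating_graph:
  fixes H :: "'a graph"
  assumes gen: "generating_graph P H" and dbl: "contains_disjoint H H H"
  shows "indiscompositive P"
proof -
  have H: "simple_graph H" "\<And>G. G \<in> P \<longleftrightarrow> fin_graph G \<and> G \<le>\<^sub>g H"
    using gen by (auto simp: generating_graph_def)
  have "\<exists>K\<in>P. contains_disjoint K A B" if AB: "A \<in> P" "B \<in> P" for A B
  proof -
    have fin: "fin_graph A" "fin_graph B"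
      using AB H by auto
    have "contains_disjoint H A B"
      using AB H by (intro contains_disjoint_mono[OF dbl _ _ induced_sub_refl]) auto
    then obtain f g where fg: "embedding f A H" "embedding g B H" "f ` verts A \<inter> g ` verts B = {}"
      by (auto simp: contains_disjoint_iff)
    define C where "C = f ` verts A \<union> g ` verts B"
    have C: "finite C" "C \<subseteq> verts H"
      using fin fg by (auto simp: C_def fin_graph_def embedding_def)
    define K where "K = induced H C"
    have K: "fin_graph K" "verts K = C" "embedding id K H"
      using C H(1) by (simp_all add: K_def fin_graph_def simple_graph_induced embedding_induced)
    obtain e :: "'a \<Rightarrow> nat" where e: "inj_on e C"
      using C(1) by (meson finite_imp_inj_to_nat_seg)
    have iso: "image_graph e K \<le>\<^sub>g K" "K \<le>\<^sub>g image_graph e K"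
      using image_graph_equiv[of K e] K e by (simp_all add: fin_graph_def)
    have "contains_disjoint K A B"
      using fg unfolding K_def contains_disjoint_iff C_def by (blast intro: embedding_into_induced)
    then have "contains_disjoint (image_graph e K) A B"
      by (rule contains_disjoint_mono[OF _ induced_sub_refl induced_sub_refl iso(2)])
    moreover have "K \<le>\<^sub>g H"
      using K induced_sub_iff by blast
    then have "image_graph e K \<le>\<^sub>g H"
      by (rule induced_sub_trans[OF iso(1)])
    moreover have "fin_graph (image_graph e K)"
      using K e by (simp add: fin_graph_image_graph)
    ultimately show ?thesis
      using H by blast
  qed
  moreover have "induced_hereditary P"
    using H unfolding induced_hereditary_def by (blast intro: induced_sub_trans)
  ultimately show ?thesis
    by (simp add: indiscompositive_def)
qed

subsection \<open>Chains and countable generating graphs\<close>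

lemma graph_property_image_graph:
  assumes P: "graph_property P" and G: "G \<in> P" and f: "inj_on f (verts G)"
  shows "image_graph f G \<in> P"
proof -
  have "G \<cong>\<^sub>g image_graph f G"
    unfolding graph_iso_iff using embedding_image_graph[OF graph_property_simple[OF P G] f]
    by (intro exI[of _ f]) simp
  moreover have "simple_graph (image_graph f G)"
    by (rule simple_graph_image_graph[OF graph_property_simple[OF P G] f])
  ultimately show ?thesis
    using P G unfolding graph_property_def by metis
qed

text \<open>Vertex sets are finite sets of numbers and edge sets are finite families of such sets.
  This allows a property to be enumerated.\<close>

lemma countable_fin_graphs: "countable {G :: nat graph. fin_graph G}"
proof -
  have "{G :: nat graph. fin_graph G} \<subseteq> Collect finite \<times> Collect (\<lambda>E. finite E \<and> E \<subseteq> Collect finite)"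
  proof
    fix G :: "nat graph" assume "G \<in> {G. fin_graph G}"
    then have fin: "finite (verts G)" and E: "edges G \<subseteq> Pow (verts G)"
      by (auto simp: fin_graph_def simple_graph_def)
    have "finite (edges G)"
      using fin E by (meson finite_Pow_iff finite_subset)
    moreover have "edges G \<subseteq> Collect finite"
      using fin E by (auto intro: finite_subset)
    ultimately show "G \<in> Collect finite \<times> Collect (\<lambda>E. finite E \<and> E \<subseteq> Collect finite)"
      using fin by (simp add: mem_Times_iff)
  qed
  moreover have "countable (Collect finite :: nat set set)"
    by (rule countable_Collect_finite)
  then have "countable {E. finite E \<and> E \<subseteq> (Collect finite :: nat set set)}"
    by (rule countable_Collect_finite_subset)
  ultimately show ?thesis
    using countable_Collect_finite by (meson countable_SIGMA countable_subset)
qed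

text \<open>The bigger graph is relabelled so that the given one becomes literally a part of it.\<close>

lemma indiscompositive_extension:
  assumes P: "graph_property P" "indiscompositive P" and X: "X \<in> P" and F: "F \<in> P"
  obtains Y where "Y \<in> P" "embedding id X Y" "contains_disjoint Y X X" "F \<le>\<^sub>g Y"
proof -
  obtain K1 where K1: "K1 \<in> P" "contains_disjoint K1 X X"
    using indiscompositiveE[OF P(2) X X] .
  obtain K where K: "K \<in> P" "contains_disjoint K K1 F"
    using indiscompositiveE[OF P(2) K1(1) F] .
  have le: "K1 \<le>\<^sub>g K" "F \<le>\<^sub>g K"
    using contains_disjoint_imp_induced_sub[OF K(2)] .
  have XX: "contains_disjoint K X X"
    by (rule contains_disjoint_mono[OF K1(2) induced_sub_refl induced_sub_refl le(1)])
  then obtain f where f: "embedding f X K"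
    unfolding contains_disjoint_iff by blast
  then have inj: "inj_on f (verts X)"
    by (simp add: embedding_def)
  obtain m where m: "\<forall>x\<in>verts X. x < m"
    using graph_property_fin[OF P(1) X] unfolding fin_graph_def finite_nat_set_iff_bounded by blast
  \<comment> \<open>Undo \<open>f\<close> on its image, so that \<open>e \<circ> f\<close> is the
    identity on \<open>X\<close>, and shift all other vertices past the bound \<open>m\<close>,
    where they cannot collide with vertices of \<open>X\<close>.\<close>
  define e where "e y = (if y \<in> f ` verts X then inv_into (verts X) f y else m + y)" for y
  have e_f: "e (f x) = x" if "x \<in> verts X" for x
    using that inj by (simp add: e_def)
  have e_other: "e y = m + y" if "y \<notin> f ` verts X" for y
    using that by (simp add: e_def)
  have "inj e"
  proof (rule injI)
    fix y z assume "e y = e z"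
    then show "y = z"
      using e_f e_other m
      by (cases "y \<in> f ` verts X"; cases "z \<in> f ` verts X") fastforce+
  qed
  then have e: "inj_on e (verts K)"
    by (rule inj_on_subset) simp
  define Y where "Y = image_graph e K"
  have embY: "embedding e K Y"
    unfolding Y_def by (rule embedding_image_graph[OF graph_property_simple[OF P(1) K(1)] e])
  then have KY: "K \<le>\<^sub>g Y"
    using induced_sub_iff by blast
  have "embedding (e \<circ> f) X Y"
    using f embY by (rule embedding_comp)
  then have "embedding id X Y"
    using e_f by (simp add: embedding_def inj_on_def image_subset_iff)
  moreover have "Y \<in> P"
    unfolding Y_def by (rule graph_property_image_graph[OF P(1) K(1) e])
  moreover have "contains_disjoint Y X X"
    by (rule contains_disjoint_mono[OF XX induced_sub_refl induced_sub_refl KY])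
  moreover have "F \<le>\<^sub>g Y"
    using le(2) KY by (rule induced_sub_trans)
  ultimately show ?thesis
    using that by blast
qed

text \<open>Enumerate \<open>P\<close> and absorb its \<open>n\<close>-th member when passing from
  stage \<open>n\<close> to the next, doubling the stage at the same time. Stages are nested
  literally, via \<open>id\<close>, so that a union can be formed later.\<close>

lemma indiscompositive_chain:
  assumes P: "graph_property P" "indiscompositive P"
  obtains X :: "nat \<Rightarrow> nat graph" where "\<And>n. X n \<in> P" "\<And>n. embedding id (X n) (X (Suc n))"
    "\<And>n. contains_disjoint (X (Suc n)) (X n) (X n)" "\<And>F. F \<in> P \<Longrightarrow> \<exists>n. F \<le>\<^sub>g X n"
proof -
  have ne: "P \<noteq> {}"
    using P(1) by (simp add: graph_property_def)
  have "P \<subseteq> {G. fin_graph G}"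
    using graph_property_fin[OF P(1)] by blast
  then have "countable P"
    using countable_fin_graphs countable_subset by blast
  then obtain F :: "nat \<Rightarrow> nat graph" where F: "P = range F"
    using uncountable_def ne by blast
  have "\<exists>X. \<forall>n. X n \<in> P \<and> (embedding id (X n) (X (Suc n)) \<and>
      contains_disjoint (X (Suc n)) (X n) (X n) \<and> F n \<le>\<^sub>g X (Suc n))"
  proof (rule dependent_nat_choice)
    show "\<exists>X. X \<in> P"
      using ne by blast
  next
    fix X n assume "X \<in> P"
    moreover have "F n \<in> P"
      using F by blast
    ultimately show "\<exists>Y. Y \<in> P \<and> (embedding id X Y \<and> contains_disjoint Y X X \<and> F n \<le>\<^sub>g Y)"
      by (metis indiscompositive_extension[OF P])
  qed
  then obtain X where X: "\<And>n. X n \<in> P" "\<And>n. embedding id (X n) (X (Suc n))"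
    "\<And>n. contains_disjoint (X (Suc n)) (X n) (X n)" "\<And>n. F n \<le>\<^sub>g X (Suc n)"
    by blast
  have "\<exists>n. G \<le>\<^sub>g X n" if "G \<in> P" for G
    using that X(4) F by blast
  with X(1-3) show ?thesis
    by (rule that)
qed

text \<open>A finite graph below \<open>H\<close> uses only finitely many vertices of
  \<open>H\<close>, so it suffices to control the finite induced pieces; heredity does the
  rest.\<close>

lemma generating_graphI:
  fixes H :: "'a graph"
  assumes P: "graph_property P" "induced_hereditary P" and H: "simple_graph H"
    and le: "\<And>F. F \<in> P \<Longrightarrow> F \<le>\<^sub>g H"
    and fin: "\<And>A. finite A \<Longrightarrow> A \<subseteq> verts H \<Longrightarrow> \<exists>F\<in>P. induced H A \<le>\<^sub>g F"
  shows "generating_graph P H"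
proof -
  have "G \<in> P" if G: "fin_graph G" "G \<le>\<^sub>g H" for G
  proof -
    obtain f where f: "embedding f G H"
      using G(2) induced_sub_iff by blast
    have "finite (f ` verts G)" "f ` verts G \<subseteq> verts H"
      using f G(1) by (simp_all add: embedding_def fin_graph_def)
    then obtain F where F: "F \<in> P" "induced H (f ` verts G) \<le>\<^sub>g F"
      using fin by metis
    have "embedding f G (induced H (f ` verts G))"
      using f by (rule embedding_into_induced) simp
    then have "G \<le>\<^sub>g F"
      using F(2) induced_sub_iff induced_sub_trans by metis
    then show ?thesis
      using P(2) F(1) G(1) induced_hereditaryD by metis
  qed
  then show ?thesis
    using H le graph_property_fin[OF P(1)] unfolding generating_graph_def by blast
qed

lemma chain_embedding_id:
  assumes "\<And>n. embedding id (X n) (X (Suc n))" "m \<le> n"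
  shows "embedding id (X m) (X n)"
  using assms(2)
proof (induction rule: dec_induct)
  case base
  show ?case
    by (rule embedding_id)
next
  case (step k)
  show ?case
    using embedding_comp[OF step.IH assms(1)] by simp
qed

lemma embedding_id_iff:
  "embedding id G H \<longleftrightarrow> verts G \<subseteq> verts H \<and>
     (\<forall>x\<in>verts G. \<forall>y\<in>verts G. {x, y} \<in> edges G \<longleftrightarrow> {x, y} \<in> edges H)"
  by (simp add: embedding_def)

text \<open>Take the union of the chain. Nesting is by induced subgraphs, so every stage is induced
  in the union, and a finite vertex set is already contained in one stage.\<close>

lemma indiscompositive_generating_graph:
  assumes P: "graph_property P" "indiscompositive P"
  obtains U :: "nat graph" where "generating_graph P U"
proof -
  obtain X :: "nat \<Rightarrow> nat graph" where X: "\<And>n. X n \<in> P" "\<And>n. embedding id (X n) (X (Suc n))"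
    "\<And>F. F \<in> P \<Longrightarrow> \<exists>n. F \<le>\<^sub>g X n"
    using indiscompositive_chain[OF P] by metis
  note chain = chain_embedding_id[of X, OF X(2)]
  have simple: "e \<subseteq> verts (X n) \<and> card e = 2" if "e \<in> edges (X n)" for e n
    using graph_property_simple[OF P(1) X(1)] that by (simp add: simple_graph_def)
  define U where "U = (\<Union>n. verts (X n), \<Union>n. edges (X n))"
  have U: "verts U = (\<Union>n. verts (X n))" "edges U = (\<Union>n. edges (X n))"
    by (simp_all add: U_def)
  have "simple_graph U"
    unfolding simple_graph_def U using simple by blast
  moreover have XU: "embedding id (X n) U" for n
    unfolding embedding_id_iff
  proof (intro conjI ballI)
    fix x y assume xy: "x \<in> verts (X n)" "y \<in> verts (X n)"
    show "{x, y} \<in> edges (X n) \<longleftrightarrow> {x, y} \<in> edges U"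
    proof
      assume "{x, y} \<in> edges U"
      then obtain m where m: "{x, y} \<in> edges (X m)"
        using U by blast
      \<comment> \<open>The edge may come from another stage \<open>m\<close>; both stages are
        induced in stage \<open>max m n\<close>, where the adjacency of \<open>x\<close> and
        \<open>y\<close> can be compared.\<close>
      then have "{x, y} \<in> edges (X (max m n))"
        using simple[OF m] chain[OF max.cobounded1[of m n]] by (simp add: embedding_id_iff)
      then show "{x, y} \<in> edges (X n)"
        using xy chain[OF max.cobounded2[of n m]] by (simp add: embedding_id_iff)
    qed (use U in blast)
  qed (use U in blast)
  moreover have "F \<le>\<^sub>g U" if "F \<in> P" for F
    using X(3)[OF that] XU induced_sub_iff induced_sub_trans by metis
  moreover have "\<exists>F\<in>P. induced U A \<le>\<^sub>g F" if A: "finite A" "A \<subseteq> verts U" for A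
  proof -
    have "\<exists>n. A \<subseteq> verts (X n)"
      using A
    proof (induction rule: finite_induct)
      case (insert a A)
      then obtain m n where "A \<subseteq> verts (X m)" "a \<in> verts (X n)"
        unfolding U by auto
      then have "insert a A \<subseteq> verts (X (max m n))"
        using chain[OF max.cobounded1[of m n]] chain[OF max.cobounded2[of n m]]
        unfolding embedding_id_iff by blast
      then show ?case
        by blast
    qed simp
    then obtain n where n: "A \<subseteq> verts (X n)"
      by blast
    have "embedding id (induced U A) (X n)"
      using n XU[of n] by (auto simp: embedding_id_iff induced_def subset_iff)
    then show ?thesis
      using X(1) induced_sub_iff by blast
  qed
  ultimately have "generating_graph P U"
    using P by (intro generating_graphI) (auto simp: indiscompositive_def)
  then show ?thesis
    using that by blast
qed

subsection \<open>Ramsey and compactness\<close>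

text \<open>Koenig's lemma for subsets, with the finite windows \<open>B k\<close> as levels:
  \<open>local\<close> says that \<open>Q k\<close> sees only the window \<open>B k\<close>, and
  \<open>antimono\<close> that later conditions imply earlier ones.\<close>

lemma coherent_set_choice:
  fixes B :: "nat \<Rightarrow> 'a set"
  assumes ex: "\<And>k. \<exists>R. Q k R"
    and local: "\<And>k R R'. R \<inter> B k = R' \<inter> B k \<Longrightarrow> Q k R \<Longrightarrow> Q k R'"
    and antimono: "\<And>k l R. k \<le> l \<Longrightarrow> Q l R \<Longrightarrow> Q k R"
    and B: "\<And>k. finite (B k)" "mono B"
  shows "\<exists>R. \<forall>k. Q k R"
proof -
  obtain r where r: "\<And>k. Q k (r k)"
    using ex by metis
  \<comment> \<open>\<open>A n\<close> is a restriction to \<open>B n\<close> shared by infinitely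
    many witnesses; this infinitude keeps the choice extendable.\<close>
  have "\<exists>A. \<forall>n. infinite {k. r k \<inter> B n = A n} \<and> A (Suc n) \<inter> B n = A n"
  proof (rule dependent_nat_choice)
    have "finite (range (\<lambda>k. r k \<inter> B 0))"
      by (rule finite_subset[of _ "Pow (B 0)"]) (use B(1) in auto)
    then show "\<exists>A. infinite {k. r k \<inter> B 0 = A}"
      using pigeonhole_infinite[of "UNIV :: nat set" "\<lambda>k. r k \<inter> B 0"] by auto
  next
    fix A n assume A: "infinite {k. r k \<inter> B n = A}"
    have "finite ((\<lambda>k. r k \<inter> B (Suc n)) ` {k. r k \<inter> B n = A})"
      by (rule finite_subset[of _ "Pow (B (Suc n))"]) (use B(1) in auto)
    \<comment> \<open>Pigeonhole among the witnesses that already restrict to \<open>A\<close>, so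
      the restriction chosen on the next window extends \<open>A\<close>.\<close>
    then obtain k where k: "r k \<inter> B n = A"
      "infinite {l \<in> {k. r k \<inter> B n = A}. r l \<inter> B (Suc n) = r k \<inter> B (Suc n)}"
      using pigeonhole_infinite[OF A] by blast
    have "infinite {l. r l \<inter> B (Suc n) = r k \<inter> B (Suc n)}"
      using k(2) by (rule infinite_super[rotated]) blast
    moreover have "r k \<inter> B (Suc n) \<inter> B n = A"
      using k(1) monoD[OF B(2), of n "Suc n"] by auto
    ultimately show "\<exists>A'. infinite {k. r k \<inter> B (Suc n) = A'} \<and> A' \<inter> B n = A"
      by blast
  qed
  then obtain A where A: "\<And>n. infinite {k. r k \<inter> B n = A n}" "\<And>n. A (Suc n) \<inter> B n = A n"
    by blast
  have A_sub: "A n \<subseteq> B n" for n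
  proof -
    obtain k where "r k \<inter> B n = A n"
      using infinite_imp_nonempty[OF A(1)[of n]] by blast
    then show ?thesis
      by blast
  qed
  have A_le: "A n \<inter> B m = A m" if "m \<le> n" for m n
    using that
  proof (induction rule: dec_induct)
    case base
    then show ?case
      using A_sub by blast
  next
    case (step n)
    have "A (Suc n) \<inter> B m = (A (Suc n) \<inter> B n) \<inter> B m"
      using monoD[OF B(2) step.hyps(1)] by blast
    then show ?case
      using A(2) step.IH by simp
  qed
  have "(\<Union>n. A n) \<inter> B m = A m" for m
  proof -
    have "A n \<inter> B m \<subseteq> A m" for n
      using A_le[of m n] A_le[of n m] A_sub[of m] by (cases "m \<le> n") auto
    then show ?thesis
      using A_sub by blast
  qed
  moreover have "Q m R" if "R \<inter> B m = A m" for R m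
  proof -
    \<comment> \<open>Infinitely many witnesses restrict to \<open>A m\<close>, so one has index at
      least \<open>m\<close>; it satisfies \<open>Q m\<close> by \<open>antimono\<close>, and
      \<open>local\<close> passes this on to \<open>R\<close>.\<close>
    obtain k where "k \<ge> m" "r k \<inter> B m = A m"
      using A(1)[of m] unfolding infinite_nat_iff_unbounded_le by blast
    then show ?thesis
      using local[of "r k" m R] antimono[OF _ r] that by simp
  qed
  ultimately have "Q m (\<Union>n. A n)" for m
    by simp
  then show ?thesis
    by blast
qed

text \<open>Finite Ramsey for pairs, with colours in any finite set. \<open>N\<close> is fixed
  before the colouring because the graph to be coloured is built from \<open>N\<close> copies.
  Listing the homogeneous set in increasing order gives \<open>e\<close>.\<close>

lemma ramsey_increasing_pairs:
  fixes C :: "'c set" and k :: nat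
  assumes "finite C"
  shows "\<exists>N :: nat. \<forall>col. (\<forall>i j. i < j \<and> j < N \<longrightarrow> col i j \<in> C) \<longrightarrow>
     (\<exists>c e. strict_mono_on {..<k} e \<and> e ` {..<k} \<subseteq> {..<N} \<and>
        (\<forall>i j. i < j \<and> j < k \<longrightarrow> col (e i) (e j) = c))"
proof -
  obtain b where b: "bij_betw b C {0..<card C}"
    using ex_bij_betw_finite_nat[OF assms] by blast
  obtain N :: nat where N: "partn_lst {..<N} (replicate (card C) k) 2"
    using ramsey_full by blast
  show ?thesis
  proof (intro exI[of _ N] allI impI)
    fix col :: "nat \<Rightarrow> nat \<Rightarrow> 'c" assume col: "\<forall>i j. i < j \<and> j < N \<longrightarrow> col i j \<in> C"
    \<comment> \<open>\<open>Min\<close> and \<open>Max\<close> recover the order of a pair, so a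
      colouring of increasing pairs becomes one of two-element sets; \<open>b\<close> numbers the
      colours as \<open>partn_lst\<close> expects.\<close>
    define f where "f p = b (col (Min p) (Max p))" for p
    have "f \<in> nsets {..<N} 2 \<rightarrow> {..<card C}"
    proof
      fix p assume "p \<in> nsets {..<N} 2"
      then obtain x y where xy: "p = {x, y}" "x < y" "y < N"
        by (auto simp: ordered_nsets_2_eq)
      then show "f p \<in> {..<card C}"
        using bij_betwE[OF b] col by (auto simp: f_def)
    qed
    then obtain i Y where Y: "i < card C" "Y \<in> nsets {..<N} k" "f ` nsets Y 2 \<subseteq> {i}"
      using partn_lstE[OF N] by (metis length_replicate nth_replicate)
    define xs where "xs = sorted_list_of_set Y"
    have fin: "finite Y" "Y \<subseteq> {..<N}" "card Y = k"
      using Y(2) by (auto simp: nsets_def)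
    then have xs: "set xs = Y" "length xs = k"
      by (simp_all add: xs_def)
    have less: "xs ! m < xs ! n" if "m < n" "n < k" for m n
      using sorted_wrt_nth_less[OF strict_sorted_list_of_set[of Y]] that xs by (simp add: xs_def)
    have mem: "xs ! n \<in> Y" if "n < k" for n
      using that xs nth_mem by blast
    have "col (xs ! m) (xs ! n) = inv_into C b i" if mn: "m < n" "n < k" for m n
    proof -
      have lt: "xs ! m < xs ! n" "xs ! m \<in> Y" "xs ! n \<in> Y"
        using less mem mn by auto
      then have "{xs ! m, xs ! n} \<in> nsets Y 2"
        by simp
      then have "f {xs ! m, xs ! n} = i"
        using Y(3) by blast
      then have "b (col (xs ! m) (xs ! n)) = i"
        using lt(1) by (simp add: f_def)
      moreover have "col (xs ! m) (xs ! n) \<in> C"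
        using lt fin(2) col by auto
      ultimately show ?thesis
        using b by (metis bij_betw_inv_into_left)
    qed
    moreover have "strict_mono_on {..<k} ((!) xs)"
      using less by (simp add: strict_mono_on_def)
    moreover have "(!) xs ` {..<k} \<subseteq> {..<N}"
      using mem fin(2) by blast
    ultimately show "\<exists>c e. strict_mono_on {..<k} e \<and> e ` {..<k} \<subseteq> {..<N} \<and>
        (\<forall>i j. i < j \<and> j < k \<longrightarrow> col (e i) (e j) = c)"
      by blast
  qed
qed

subsection \<open>Indiscernible copies\<close>

text \<open>The maps are kept rather than just their images: a vertex of \<open>X\<close> then has a
  named counterpart in each copy, and adjacency patterns between copies can be compared.\<close>

definition disjoint_copies :: "nat \<Rightarrow> (nat \<Rightarrow> 'a \<Rightarrow> 'b) \<Rightarrow> 'a graph \<Rightarrow> 'b graph \<Rightarrow> bool" where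
  "disjoint_copies k h X K \<longleftrightarrow> (\<forall>i<k. embedding (h i) X K) \<and>
     (\<forall>i<k. \<forall>j<k. i \<noteq> j \<longrightarrow> h i ` verts X \<inter> h j ` verts X = {})"

lemma indiscompositive_disjoint_copies:
  assumes P: "indiscompositive P" and X: "X \<in> P"
  shows "\<exists>K\<in>P. \<exists>h. disjoint_copies k h X K"
proof (induction k)
  case 0
  then show ?case
    using X by (auto simp: disjoint_copies_def)
next
  case (Suc k)
  then obtain K h where K: "K \<in> P" "disjoint_copies k h X K"
    by blast
  obtain L where L: "L \<in> P" "contains_disjoint L K X"
    using indiscompositiveE[OF P K(1) X] .
  then obtain f g where fg: "embedding f K L" "embedding g X L" "f ` verts K \<inter> g ` verts X = {}"
    unfolding contains_disjoint_iff by blast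
  have h: "embedding (h i) X K" "h i ` verts X \<subseteq> verts K" if "i < k" for i
    using K(2) that by (auto simp: disjoint_copies_def embedding_def)
  define h' where "h' i = (if i < k then f \<circ> h i else g)" for i
  have "embedding (h' i) X L" for i
    using fg(2) embedding_comp[OF h(1) fg(1)] by (simp add: h'_def)
  moreover have "h' i ` verts X \<inter> h' j ` verts X = {}" if ij: "i < j" "j < Suc k" for i j
  proof (cases "j < k")
    case True
    have "f ` h i ` verts X \<inter> f ` h j ` verts X = f ` (h i ` verts X \<inter> h j ` verts X)"
      using fg(1) h ij True by (intro inj_on_image_Int[symmetric, of _ "verts K"]) (auto simp: embedding_def)
    then show ?thesis
      using K(2) ij True by (simp add: h'_def image_comp disjoint_copies_def)
  next
    case False
    then have "h' i ` verts X \<subseteq> f ` verts K" "h' j = g"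
      using h(2)[of i] ij by (auto simp: h'_def)
    then show ?thesis
      using fg(3) by blast
  qed
  then have "h' i ` verts X \<inter> h' j ` verts X = {}" if "i < Suc k" "j < Suc k" "i \<noteq> j" for i j
    using that by (metis Int_commute linorder_neqE_nat)
  ultimately have "disjoint_copies (Suc k) h' X L"
    unfolding disjoint_copies_def by blast
  then show ?case
    using L(1) by blast
qed

text \<open>\<open>R\<close> need not be symmetric: its first component belongs to the copy of
  smaller index. For distinct indices only their order matters.\<close>

definition indiscernible_copies :: "'a graph \<Rightarrow> ('a \<times> 'a) set \<Rightarrow> ('a \<times> nat) graph" where
  "indiscernible_copies U R =
     (verts U \<times> UNIV,
      {{(s, i), (t, i)} | s t i. s \<in> verts U \<and> t \<in> verts U \<and> {s, t} \<in> edges U} \<union>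
      {{(s, i), (t, j)} | s t i j. s \<in> verts U \<and> t \<in> verts U \<and> i < j \<and> (s, t) \<in> R})"

lemma verts_indiscernible_copies [simp]: "verts (indiscernible_copies U R) = verts U \<times> UNIV"
  by (simp add: indiscernible_copies_def)

text \<open>An edge is an unordered pair, so for \<open>j < i\<close> it is read starting from copy
  \<open>j\<close>, which swaps the arguments of \<open>R\<close>.\<close>

lemma edge_indiscernible_copies:
  assumes "s \<in> verts U" "t \<in> verts U"
  shows "{(s, i), (t, j)} \<in> edges (indiscernible_copies U R) \<longleftrightarrow>
    (if i = j then {s, t} \<in> edges U else if i < j then (s, t) \<in> R else (t, s) \<in> R)"
  using assms unfolding indiscernible_copies_def
  by (auto simp: doubleton_eq_iff insert_commute)

lemma simple_graph_indiscernible_copies: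
  assumes "simple_graph U"
  shows "simple_graph (indiscernible_copies U R)"
proof -
  have "s \<noteq> t" if "{s, t} \<in> edges U" for s t
    using assms that by (auto simp: simple_graph_def)
  then show ?thesis
    unfolding simple_graph_def indiscernible_copies_def by (auto simp: card_insert_if)
qed

text \<open>Adjacency depends on the indices only through their order, which a strictly increasing
  map preserves.\<close>

lemma embedding_indiscernible_copies_reindex:
  assumes "strict_mono e"
  shows "embedding (\<lambda>(s, i). (s, e i)) (indiscernible_copies U R) (indiscernible_copies U R)"
proof -
  have "inj e"
    using assms by (rule strict_mono_imp_inj_on)
  show ?thesis
    unfolding embedding_def verts_indiscernible_copies
  proof (intro conjI ballI)
    fix x y assume "x \<in> verts U \<times> (UNIV :: nat set)" "y \<in> verts U \<times> (UNIV :: nat set)"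
    then obtain s i t j where xy: "x = (s, i)" "y = (t, j)" "s \<in> verts U" "t \<in> verts U"
      by (metis SigmaE)
    then show "{x, y} \<in> edges (indiscernible_copies U R) \<longleftrightarrow>
        {case x of (s, i) \<Rightarrow> (s, e i), case y of (s, i) \<Rightarrow> (s, e i)}
          \<in> edges (indiscernible_copies U R)"
      by (simp add: edge_indiscernible_copies strict_mono_less[OF assms] inj_eq[OF \<open>inj e\<close>])
  qed (use inj_eq[OF \<open>inj e\<close>] in \<open>auto simp: inj_on_def\<close>)
qed

lemma contains_disjoint_indiscernible_copies:
  "contains_disjoint (indiscernible_copies U R) (indiscernible_copies U R) (indiscernible_copies U R)"
proof -
  have "(\<lambda>(s, i). (s, 2 * i)) ` (verts U \<times> UNIV) \<inter> (\<lambda>(s, i). (s, Suc (2 * i))) ` (verts U \<times> UNIV) = {}"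
    by (auto, presburger)
  moreover have "strict_mono (\<lambda>i :: nat. 2 * i)" "strict_mono (\<lambda>i :: nat. Suc (2 * i))"
    by (simp_all add: strict_mono_def)
  ultimately show ?thesis
    unfolding contains_disjoint_iff verts_indiscernible_copies
    using embedding_indiscernible_copies_reindex by blast
qed

lemma induced_sub_indiscernible_copies: "U \<le>\<^sub>g indiscernible_copies U R"
proof -
  have "embedding (\<lambda>s. (s, 0)) U (indiscernible_copies U R)"
    by (auto simp: embedding_def edge_indiscernible_copies inj_on_def)
  then show ?thesis
    using induced_sub_iff by blast
qed

text \<open>The finite approximation for the compactness argument: \<open>k\<close> bounds both the
  labels taken from \<open>U\<close> and the number of copies, so \<open>R\<close> matters only on
  pairs below \<open>k\<close> and the pieces exhaust the whole graph.\<close>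

definition realises_copies :: "nat graph set \<Rightarrow> nat graph \<Rightarrow> nat \<Rightarrow> (nat \<times> nat) set \<Rightarrow> bool" where
  "realises_copies P U k R \<longleftrightarrow>
     (\<exists>F\<in>P. induced (indiscernible_copies U R) ((verts U \<inter> {..<k}) \<times> {..<k}) \<le>\<^sub>g F)"

text \<open>Ramsey's theorem supplies the pattern: among sufficiently many disjoint copies of the
  piece of \<open>U\<close> below \<open>k\<close>, inside one graph of \<open>P\<close>, some
  \<open>k\<close> are pairwise joined in the same way.\<close>

lemma indiscompositive_realises_copies:
  assumes P: "graph_property P" "indiscompositive P" and gen: "generating_graph P (U :: nat graph)"
  shows "\<exists>R. realises_copies P U k R"
proof -
  define S where "S = verts U \<inter> {..<k}"
  define X where "X = induced U S"
  have "fin_graph X" "X \<le>\<^sub>g U"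
    using gen embedding_induced[of S U] unfolding induced_sub_iff
    by (auto simp: X_def S_def fin_graph_def generating_graph_def simple_graph_induced)
  then have X: "X \<in> P"
    using gen by (simp add: generating_graph_def)
  have [simp]: "verts X = S"
    by (simp add: X_def)
  have fin: "finite (Pow (S \<times> S))"
    by (simp add: S_def)
  obtain N :: nat where N: "\<forall>col. (\<forall>i j. i < j \<and> j < N \<longrightarrow> col i j \<in> Pow (S \<times> S)) \<longrightarrow>
      (\<exists>R e. strict_mono_on {..<k} e \<and> e ` {..<k} \<subseteq> {..<N} \<and>
         (\<forall>i j. i < j \<and> j < k \<longrightarrow> col (e i) (e j) = R))"
    using ramsey_increasing_pairs[OF fin, of k] by (elim exE)
  obtain K h where K: "K \<in> P" "disjoint_copies N h X K"
    using indiscompositive_disjoint_copies[OF P(2) X] by blast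
  \<comment> \<open>The colour of two copies is the bipartite adjacency between them, written as a
    relation on the finite set \<open>S\<close>, so there are finitely many colours.\<close>
  define col where "col i j = {(s, t) \<in> S \<times> S. {h i s, h j t} \<in> edges K}" for i j
  obtain R e where e: "strict_mono_on {..<k} e" "e ` {..<k} \<subseteq> {..<N}"
    and R: "\<And>i j. i < j \<Longrightarrow> j < k \<Longrightarrow> col (e i) (e j) = R"
  proof -
    have "\<forall>i j. i < j \<and> j < N \<longrightarrow> col i j \<in> Pow (S \<times> S)"
      by (auto simp: col_def)
    from mp[OF spec[OF N] this] show ?thesis
      by (elim exE conjE) (use that in simp)
  qed
  have h: "inj_on (h (e i)) S" "h (e i) ` S \<subseteq> verts K"
    "\<And>s t. s \<in> S \<Longrightarrow> t \<in> S \<Longrightarrow> {h (e i) s, h (e i) t} \<in> edges K \<longleftrightarrow> {s, t} \<in> edges U" if "i < k" for i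
  proof -
    have "embedding (h (e i)) X K"
      using K(2) e(2) that by (auto simp: disjoint_copies_def)
    then show "inj_on (h (e i)) S" "h (e i) ` S \<subseteq> verts K"
      "\<And>s t. s \<in> S \<Longrightarrow> t \<in> S \<Longrightarrow> {h (e i) s, h (e i) t} \<in> edges K \<longleftrightarrow> {s, t} \<in> edges U"
      by (simp_all add: embedding_def) (simp add: X_def induced_def)
  qed
  have disj: "h (e i) ` S \<inter> h (e j) ` S = {}" if "i < k" "j < k" "i \<noteq> j" for i j
  proof -
    have "e i \<noteq> e j"
      using strict_mono_on_imp_inj_on[OF e(1)] that by (auto simp: inj_on_def)
    then show ?thesis
      using K(2) e(2) that by (auto simp: disjoint_copies_def image_subset_iff)
  qed
  have lt: "{h (e i) s, h (e j) t} \<in> edges K \<longleftrightarrow> (s, t) \<in> R"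
    if "i < j" "j < k" "s \<in> S" "t \<in> S" for i j s t
    using R[OF that(1,2), symmetric] that(3,4) by (simp add: col_def)
  have SU: "s \<in> verts U" if "s \<in> S" for s
    using that by (simp add: S_def)
  let ?H = "indiscernible_copies U R"
  \<comment> \<open>Copy \<open>i\<close> goes to the copy of index \<open>e i\<close> in
    \<open>K\<close>; for \<open>i < j\<close> the adjacency between these two is \<open>R\<close>,
    by homogeneity.\<close>
  have "embedding (\<lambda>(s, i). h (e i) s) (induced ?H (S \<times> {..<k})) K"
    unfolding embedding_def verts_induced
  proof (intro conjI ballI)
    show "inj_on (\<lambda>(s, i). h (e i) s) (S \<times> {..<k})"
    proof (rule inj_onI, clarify)
      fix s i t j
      assume *: "s \<in> S" "i < k" "t \<in> S" "j < k" "h (e i) s = h (e j) t"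
      then have "i = j"
        using disj[of i j] by blast
      then show "s = t \<and> i = j"
        using * h(1)[of i] by (auto simp: inj_on_def)
    qed
    show "(\<lambda>(s, i). h (e i) s) ` (S \<times> {..<k}) \<subseteq> verts K"
      using h(2) by auto
  next
    fix x y assume "x \<in> S \<times> {..<k}" "y \<in> S \<times> {..<k}"
    then obtain s i t j where xy: "x = (s, i)" "y = (t, j)" "s \<in> S" "t \<in> S" "i < k" "j < k"
      by auto
    have "{(s, i), (t, j)} \<in> edges (induced ?H (S \<times> {..<k})) \<longleftrightarrow> {(s, i), (t, j)} \<in> edges ?H"
      using xy by (simp add: induced_def)
    also have "\<dots> \<longleftrightarrow> (if i = j then {s, t} \<in> edges U else if i < j then (s, t) \<in> R else (t, s) \<in> R)"
      by (rule edge_indiscernible_copies[OF SU SU]) (use xy in auto)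
    also have "\<dots> \<longleftrightarrow> {h (e i) s, h (e j) t} \<in> edges K"
      using xy h(3) lt[of i j s t] lt[of j i t s] by (auto simp: insert_commute)
    finally show "{x, y} \<in> edges (induced ?H (S \<times> {..<k})) \<longleftrightarrow>
        {case x of (s, i) \<Rightarrow> h (e i) s, case y of (s, i) \<Rightarrow> h (e i) s} \<in> edges K"
      by (simp add: xy)
  qed
  then show ?thesis
    unfolding realises_copies_def S_def using K(1) induced_sub_iff by blast
qed

text \<open>All labels in the piece are below \<open>k\<close>, so its edges consult
  \<open>R\<close> only there: the locality that \<open>coherent_set_choice\<close> asks
  for.\<close>

lemma realises_copies_local:
  assumes R: "R \<inter> {..<k} \<times> {..<k} = R' \<inter> {..<k} \<times> {..<k}" and real: "realises_copies P U k R"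
  shows "realises_copies P U k R'"
proof -
  let ?A = "(verts U \<inter> {..<k}) \<times> {..<k}"
  have "embedding id (induced (indiscernible_copies U R') ?A) (induced (indiscernible_copies U R) ?A)"
    unfolding embedding_id_iff verts_induced
  proof (intro conjI ballI subset_refl)
    fix x y assume "x \<in> ?A" "y \<in> ?A"
    then obtain s i t j where xy: "x = (s, i)" "y = (t, j)" "s \<in> verts U" "t \<in> verts U"
      "s < k" "t < k" "i < k" "j < k"
      by auto
    then have "(s, t) \<in> R \<longleftrightarrow> (s, t) \<in> R'" "(t, s) \<in> R \<longleftrightarrow> (t, s) \<in> R'"
      using R by auto
    then show "{x, y} \<in> edges (induced (indiscernible_copies U R') ?A) \<longleftrightarrow>
        {x, y} \<in> edges (induced (indiscernible_copies U R) ?A)"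
      using xy by (simp add: induced_def edge_indiscernible_copies)
  qed
  then show ?thesis
    using real induced_sub_iff induced_sub_trans unfolding realises_copies_def by metis
qed

lemma induced_sub_induced: "A \<subseteq> B \<Longrightarrow> induced G A \<le>\<^sub>g induced G B"
  unfolding induced_sub_iff
  by (intro exI[of _ id]) (auto simp: embedding_id_iff induced_def)

lemma realises_copies_antimono:
  assumes "k \<le> l" "realises_copies P U l R"
  shows "realises_copies P U k R"
proof -
  have "(verts U \<inter> {..<k}) \<times> {..<k} \<subseteq> (verts U \<inter> {..<l}) \<times> {..<l}"
    using assms(1) by auto
  then show ?thesis
    using assms(2) induced_sub_induced induced_sub_trans unfolding realises_copies_def by metis
qed

text \<open>Compactness gives one pattern for all finite pieces. The resulting graph contains
  \<open>U\<close>, hence every member of \<open>P\<close>, while its finite parts lie in pieces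
  realised in \<open>P\<close>.\<close>

lemma indiscompositive_self_doubling_extension:
  assumes P: "graph_property P" "indiscompositive P" and gen: "generating_graph P (U :: nat graph)"
  obtains H :: "(nat \<times> nat) graph" where "generating_graph P H" "U \<le>\<^sub>g H" "contains_disjoint H H H"
proof -
  have "\<exists>R. \<forall>k. realises_copies P U k R"
  proof (rule coherent_set_choice[of "realises_copies P U" "\<lambda>k. {..<k} \<times> {..<k}"])
    show "mono (\<lambda>k :: nat. {..<k} \<times> {..<k})"
      by (auto simp: mono_def)
    show "\<exists>R. realises_copies P U k R" for k
      by (rule indiscompositive_realises_copies[OF P gen])
  qed (erule realises_copies_local realises_copies_antimono, assumption | simp)+
  then obtain R where R: "\<And>k. realises_copies P U k R"
    by blast
  let ?H = "indiscernible_copies U R"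
  have UH: "U \<le>\<^sub>g ?H"
    by (rule induced_sub_indiscernible_copies)
  have "generating_graph P ?H"
  proof (rule generating_graphI[OF P(1)])
    show "induced_hereditary P"
      using P(2) by (simp add: indiscompositive_def)
    show "simple_graph ?H"
      using gen by (simp add: generating_graph_def simple_graph_indiscernible_copies)
    show "F \<le>\<^sub>g ?H" if "F \<in> P" for F
    proof -
      have "F \<le>\<^sub>g U"
        using that gen by (simp add: generating_graph_def)
      then show ?thesis
        using UH by (rule induced_sub_trans)
    qed
    fix A assume A: "finite A" "A \<subseteq> verts ?H"
    \<comment> \<open>\<open>k\<close> exceeds all labels and all copy indices in \<open>A\<close>,
      so \<open>A\<close> lies in a single realised piece.\<close>
    obtain k where k: "\<forall>n \<in> fst ` A \<union> snd ` A. n < k"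
      using A(1) finite_nat_set_iff_bounded[of "fst ` A \<union> snd ` A"] by auto
    have "A \<subseteq> (verts U \<inter> {..<k}) \<times> {..<k}"
    proof
      fix x assume "x \<in> A"
      then have "x \<in> verts U \<times> UNIV" "fst x < k" "snd x < k"
        using A(2) k by auto
      then show "x \<in> (verts U \<inter> {..<k}) \<times> {..<k}"
        by (simp add: mem_Times_iff)
    qed
    then show "\<exists>F\<in>P. induced ?H A \<le>\<^sub>g F"
      using R[of k] induced_sub_induced induced_sub_trans unfolding realises_copies_def by metis
  qed
  then show ?thesis
    using UH contains_disjoint_indiscernible_copies by (rule that)
qed

section \<open>Transfer between vertex types\<close>

lemma generating_graph_image_graph:
  assumes gen: "generating_graph P G" and f: "inj_on f (verts G)"
  shows "generating_graph P (image_graph f G)"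
proof -
  have G: "simple_graph G"
    using gen by (simp add: generating_graph_def)
  have "F \<le>\<^sub>g image_graph f G \<longleftrightarrow> F \<le>\<^sub>g G" for F :: "nat graph"
    using image_graph_equiv[OF G f] induced_sub_trans by metis
  then show ?thesis
    using gen simple_graph_image_graph[OF G f] by (simp add: generating_graph_def)
qed

text \<open>Number the vertices of \<open>G\<close>, extend over \<open>nat \<times> nat\<close>,
  and carry the result injectively into \<open>'a\<close>. The vertex type of \<open>G\<close> is
  independent of \<open>'a\<close>, so that graphs over \<open>nat\<close> can also serve as a
  start.\<close>

lemma indiscompositive_self_doubling_extension_type:
  assumes P: "graph_property P" "indiscompositive P"
    and inf: "infinite (UNIV :: 'a set)"
    and gen: "generating_graph P (G :: 'b graph)" and cnt: "countable (verts G)"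
  shows "\<exists>H :: 'a graph. generating_graph P H \<and> G \<le>\<^sub>g H \<and> (\<exists>M \<in> 2\<circledast> H. M \<le>\<^sub>g H)"
proof -
  have G: "simple_graph G" "inj_on (to_nat_on (verts G)) (verts G)"
    using gen cnt by (simp_all add: generating_graph_def inj_on_to_nat_on)
  obtain H :: "(nat \<times> nat) graph" where H: "generating_graph P H"
    "image_graph (to_nat_on (verts G)) G \<le>\<^sub>g H" "contains_disjoint H H H"
    by (rule indiscompositive_self_doubling_extension[OF P generating_graph_image_graph[OF gen G(2)]])
  obtain a :: "nat \<Rightarrow> 'a" where "inj a"
    using infinite_countable_subset[OF inf] by blast
  then have f: "inj_on (a \<circ> prod_encode) (verts H)"
    using inj_prod_encode by (rule inj_on_subset[OF inj_compose]) simp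
  define H' where "H' = image_graph (a \<circ> prod_encode) H"
  have "simple_graph H"
    using H(1) by (simp add: generating_graph_def)
  then have eq: "H \<le>\<^sub>g H'" "H' \<le>\<^sub>g H"
    unfolding H'_def using f by (rule image_graph_equiv)+
  have gen': "generating_graph P H'"
    unfolding H'_def using H(1) f by (rule generating_graph_image_graph)
  have "G \<le>\<^sub>g H'"
    by (rule induced_sub_trans[OF induced_sub_trans[OF image_graph_equiv(1)[OF G] H(2)] eq(1)])
  moreover have "contains_disjoint H' H' H'"
    by (rule contains_disjoint_mono[OF H(3) eq(2) eq(2) eq(1)])
  then have "\<exists>M \<in> 2\<circledast> H'. M \<le>\<^sub>g H'"
    using gen' by (simp add: ex_two_copies_iff generating_graph_def)
  ultimately show ?thesis
    using gen' by blast
qed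

section \<open>Equivalence of indiscompositivity with (B), (C) and (D)\<close>

lemma indiscompositive_iff_generating_containing:
  assumes P: "graph_property P"
  shows "indiscompositive P \<longleftrightarrow>
    (\<exists>\<G>. generating_set P \<G>) \<and>
    (\<forall>L\<in>P. \<forall>\<G>. generating_set P \<G> \<longrightarrow> generating_set P (containing_some \<G> (2\<circledast> L)))"
    (is "_ \<longleftrightarrow> ?B")
proof
  assume ind: "indiscompositive P"
  then have "generating_set P P"
    by (simp add: indiscompositive_def generating_set_self)
  then show ?B
    using indiscompositive_imp_generating_containing[OF P ind] by blast
next
  assume ?B
  then obtain \<G> where "generating_set P \<G>"
    by blast
  then show "indiscompositive P"
    by (rule indiscompositive_if_generating_containing[OF P]) (use \<open>?B\<close> in simp)
qed

lemma indiscompositive_iff_chain: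
  assumes P: "graph_property P"
  shows "indiscompositive P \<longleftrightarrow>
    (\<exists>G :: nat \<Rightarrow> nat graph. generating_set P (range G) \<and> (\<forall>i. G i \<le>\<^sub>g G (Suc i)) \<and>
       (\<forall>i. \<exists>M \<in> 2\<circledast> (G i). M \<le>\<^sub>g G (Suc i)))"
    (is "_ \<longleftrightarrow> ?C")
proof
  assume ind: "indiscompositive P"
  obtain X :: "nat \<Rightarrow> nat graph" where X: "\<And>n. X n \<in> P" "\<And>n. embedding id (X n) (X (Suc n))"
    "\<And>n. contains_disjoint (X (Suc n)) (X n) (X n)" "\<And>F. F \<in> P \<Longrightarrow> \<exists>n. F \<le>\<^sub>g X n"
    using indiscompositive_chain[OF P ind] by metis
  have "generating_set P (range X)"
    using ind X(1,4) by (auto simp: generating_set_hereditary indiscompositive_def)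
  moreover have "X n \<le>\<^sub>g X (Suc n)" for n
    using X(2) induced_sub_iff by blast
  moreover have "\<exists>M \<in> 2\<circledast> (X n). M \<le>\<^sub>g X (Suc n)" for n
    using X(3) by (simp add: ex_two_copies_iff graph_property_simple[OF P X(1)])
  ultimately show ?C
    by blast
next
  assume ?C
  then obtain G :: "nat \<Rightarrow> nat graph" where G: "generating_set P (range G)"
    "\<And>i. G i \<le>\<^sub>g G (Suc i)" "\<And>i. \<exists>M \<in> 2\<circledast> (G i). M \<le>\<^sub>g G (Suc i)"
    by blast
  have "simple_graph (G i)" for i
    using generating_set_subset[OF G(1)] graph_property_simple[OF P] by (simp add: image_subset_iff)
  then have "contains_disjoint (G (Suc i)) (G i) (G i)" for i
    using G(3) by (simp add: ex_two_copies_iff)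
  then show "indiscompositive P"
    by (rule indiscompositive_if_chain[OF G(1,2)])
qed

lemma indiscompositive_iff_self_doubling_generating_graph:
  assumes P: "graph_property P" and inf: "infinite (UNIV :: 'a set)"
  shows "indiscompositive P \<longleftrightarrow>
    (\<exists>H :: 'a graph. generating_graph P H \<and> (\<exists>M \<in> 2\<circledast> H. M \<le>\<^sub>g H)) \<and>
    (\<forall>G :: 'a graph. generating_graph P G \<and> countable (verts G) \<longrightarrow>
       (\<exists>H :: 'a graph. generating_graph P H \<and> G \<le>\<^sub>g H \<and> (\<exists>M \<in> 2\<circledast> H. M \<le>\<^sub>g H)))"
    (is "_ \<longleftrightarrow> ?D")
proof
  assume ind: "indiscompositive P"
  \<comment> \<open>The existence half of (D) is the extension statement applied to some countable
    generating graph; the union of a chain provides one over \<open>nat\<close>.\<close>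
  obtain U :: "nat graph" where "generating_graph P U"
    by (rule indiscompositive_generating_graph[OF P ind])
  then have "\<exists>H :: 'a graph. generating_graph P H \<and> U \<le>\<^sub>g H \<and> (\<exists>M \<in> 2\<circledast> H. M \<le>\<^sub>g H)"
    by (rule indiscompositive_self_doubling_extension_type[OF P ind inf]) simp
  then show ?D
    using indiscompositive_self_doubling_extension_type[OF P ind inf] by blast
next
  assume ?D
  then obtain H :: "'a graph" where H: "generating_graph P H" "\<exists>M \<in> 2\<circledast> H. M \<le>\<^sub>g H"
    by blast
  then have "contains_disjoint H H H"
    by (simp add: ex_two_copies_iff generating_graph_def)
  then show "indiscompositive P"
    by (rule indiscompositive_if_generating_graph[OF H(1)])
qed

theorem theorem4p2:
  fixes P :: "nat graph set"
  assumes "graph_property P"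
    and "infinite (UNIV :: 'a set)"
  shows
    "(indiscompositive P \<longleftrightarrow>
        (\<exists>\<G>. generating_set P \<G>) \<and>
        (\<forall>L\<in>P. \<forall>\<G>. generating_set P \<G> \<longrightarrow> generating_set P (containing_some \<G> (2\<circledast> L))))
   \<and> (indiscompositive P \<longleftrightarrow>
        (\<exists>G :: nat \<Rightarrow> nat graph.
           generating_set P (range G) \<and>
           (\<forall>i. G i \<le>\<^sub>g G (Suc i)) \<and>
           (\<forall>i. \<exists>M \<in> 2\<circledast> (G i). M \<le>\<^sub>g G (Suc i))))
   \<and> (indiscompositive P \<longleftrightarrow>
        (\<exists>H :: 'a graph. generating_graph P H \<and> (\<exists>M \<in> 2\<circledast> H. M \<le>\<^sub>g H)) \<and>
        (\<forall>G :: 'a graph. generating_graph P G \<and> countable (verts G) \<longrightarrow>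
           (\<exists>H :: 'a graph. generating_graph P H \<and> G \<le>\<^sub>g H \<and> (\<exists>M \<in> 2\<circledast> H. M \<le>\<^sub>g H))))"
  by (intro conjI indiscompositive_iff_generating_containing indiscompositive_iff_chain
      indiscompositive_iff_self_doubling_generating_graph assms)

end
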